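(* Let $G$ be a (finite, simple) bipartite graph with cycle rank $m(G)=4$. Then $G$ is a Parter graph if and only if $G$ has a perfect matching.
   Context: All graphs are finite and simple (not necessarily connected), and all matrices are real and symmetric. For a graph $G$ with vertex set $\{1,\dots,n\}$, let $S(G)$ be the set of real symmetric $n\times n$ matrices $A=(a_{ij})$ such that for all $i\neq j$, $a_{ij}\neq 0$ if and only if $ij$ is an edge of $G$ (diagonal entries are arbitrary). For a vertex $v$, $A(v)$ denotes the principal submatrix of $A$ obtained by deleting the row and column indexed by $v$. A graph $G$ is called a Parter graph if there exists a nonsingular matrix $A\in S(G)$ such that $\det A(v)=0$ for every vertex $v$ of $G$ (equivalently, all diagonal entries of $A^{-1}$ are zero). The cycle rank of $G$ is $m(G)=|E(G)|-|V(G)|+k(G)$, where $k(G)$ is the number of connected components of $G$ (equivalently, the dimension over $\mathbb{F}_2$ of the cycle space of $G$). A perfect matching is a set of pairwise disjoint edges covering all vertices. *)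

theory Defs
  imports "Jordan_Normal_Form.Determinant"
begin

text \<open>A graph is given by its number \<open>n\<close> of vertices and its set \<open>E\<close> of edges (two-element sets of
  vertices). The vertices are numbered \<open>0, \<dots>, n - 1\<close> so as to match the row and column indices
  of matrices.\<close>

definition simple_graph :: "nat \<Rightarrow> nat set set \<Rightarrow> bool" where
  "simple_graph n E \<longleftrightarrow> (\<forall>e\<in>E. e \<subseteq> {0..<n} \<and> card e = 2)"

definition bipartite :: "nat \<Rightarrow> nat set set \<Rightarrow> bool" where
  "bipartite n E \<longleftrightarrow> (\<exists>X Y. X \<union> Y = {0..<n} \<and> X \<inter> Y = {} \<and> (\<forall>e\<in>E. \<exists>x\<in>X. \<exists>y\<in>Y. e = {x, y}))"

definition connection :: "nat \<Rightarrow> nat set set \<Rightarrow> (nat \<times> nat) set" where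
  "connection n E = {(u, v). u < n \<and> v < n \<and> (u, v) \<in> {(x, y). {x, y} \<in> E}\<^sup>*}"

definition components :: "nat \<Rightarrow> nat set set \<Rightarrow> nat set set" where
  "components n E = {0..<n} // connection n E"

definition cycle_rank :: "nat \<Rightarrow> nat set set \<Rightarrow> int" where
  "cycle_rank n E = int (card E) - int n + int (card (components n E))"

definition has_perfect_matching :: "nat \<Rightarrow> nat set set \<Rightarrow> bool" where
  "has_perfect_matching n E \<longleftrightarrow>
     (\<exists>M \<subseteq> E. (\<forall>e\<in>M. \<forall>f\<in>M. e \<noteq> f \<longrightarrow> e \<inter> f = {}) \<and> \<Union>M = {0..<n})"

definition graph_matrices :: "nat \<Rightarrow> nat set set \<Rightarrow> real mat set" where
  "graph_matrices n E = {A \<in> carrier_mat n n. A\<^sup>T = A \<and>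
     (\<forall>i<n. \<forall>j<n. i \<noteq> j \<longrightarrow> (A $$ (i, j) \<noteq> 0 \<longleftrightarrow> {i, j} \<in> E))}"

definition parter_graph :: "nat \<Rightarrow> nat set set \<Rightarrow> bool" where
  "parter_graph n E \<longleftrightarrow>
     (\<exists>A \<in> graph_matrices n E. invertible_mat A \<and> (\<forall>v<n. det (mat_delete A v v) = 0))"

end

theory Submission
  imports Defs
begin

text \<open>Let \<open>A\<close> be nonsingular in \<open>S(G)\<close> and let \<open>B = A\<^sup>-\<^sup>1\<close> have zero diagonal. The weights
  \<open>A i j * B i j\<close> on the edges sum to one at every vertex, so the two colour classes have the same
  size. If \<open>v\<close> is a leaf with neighbour \<open>u\<close>, then row \<open>u\<close> of \<open>B\<close> is supported at \<open>v\<close>, and deleting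
  \<open>u\<close> and \<open>v\<close> preserves the situation. Hence all degrees may be assumed to be at least two, while
  cycle rank four leaves at most three more edges than vertices. Counting edges, a set \<open>S\<close> in
  one colour class that violates Hall's condition has exactly \<open>card S - 1\<close> neighbours, and at most
  one edge joins these to the complement of \<open>S\<close>; comparing weights, that edge exists and has weight
  \<open>-1\<close>. But it is a bridge, and the weight of a bridge is zero or one. Conversely, given a perfect
  matching, a matrix with zero diagonal and large entries on the matching edges is nonsingular, and
  the bipartition forces its inverse to have zero diagonal.\<close>

section \<open>Hall's theorem\<close>

text \<open>Halmos-Vaughan induction on \<open>card X\<close>. If some nonempty proper subset
  \<open>S\<close> is tight, then \<open>S\<close> and \<open>X - S\<close> are matched separately,
  the latter avoiding all neighbours of \<open>S\<close>. Otherwise every nonempty proper subset has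
  a spare neighbour, so an arbitrary \<open>x\<close> may take an arbitrary neighbour
  \<open>y\<close>.\<close>

lemma hall_marriage:
  fixes N :: "'a \<Rightarrow> 'b set"
  assumes "finite X"
    and "\<And>x. x \<in> X \<Longrightarrow> finite (N x)"
    and "\<And>S. S \<subseteq> X \<Longrightarrow> card S \<le> card (\<Union>(N ` S))"
  shows "\<exists>f. inj_on f X \<and> (\<forall>x\<in>X. f x \<in> N x)"
  using assms
proof (induction "card X" arbitrary: X N rule: less_induct)
  case less
  show ?case
  proof (cases "X = {}")
    case False
    then obtain x where x: "x \<in> X" by blast
    show ?thesis
    proof (cases "\<exists>S. S \<subseteq> X \<and> S \<noteq> {} \<and> S \<noteq> X \<and> card (\<Union>(N ` S)) = card S")
      case True
      then obtain S where S: "S \<subseteq> X" "S \<noteq> {}" "S \<noteq> X" and tight: "card (\<Union>(N ` S)) = card S"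
        by blast
      define W where "W = \<Union>(N ` S)"
      have fS: "finite S" using S less.prems(1) finite_subset by blast
      have fW: "finite W" using S fS less.prems(2) unfolding W_def by blast
      have "card S < card X" using S less.prems(1) by (simp add: psubset_card_mono psubset_eq)
      then obtain f where f: "inj_on f S" "\<forall>x\<in>S. f x \<in> N x"
        using less.hyps[OF _ fS, of N] less.prems(2,3) S(1) by (meson subsetD subset_trans)
      have "card (X - S) < card X"
        using S less.prems(1) by (intro psubset_card_mono) auto
      \<comment> \<open>Hall's condition survives the removal of \<open>W\<close>: apply it to the
        union of \<open>S\<close> and \<open>T\<close> and cancel
        \<open>card S = card W\<close>.\<close>
      moreover have "card T \<le> card (\<Union>((\<lambda>x. N x - W) ` T))" if T: "T \<subseteq> X - S" for T
      proof -
        have fT: "finite T" using T less.prems(1) by (meson finite_Diff finite_subset)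
        have fN: "finite (\<Union>((\<lambda>x. N x - W) ` T))" using fT T less.prems(2) by blast
        have "card S + card T = card (S \<union> T)"
          using fS fT T by (subst card_Un_disjoint) auto
        also have "\<dots> \<le> card (\<Union>(N ` (S \<union> T)))"
          using T S by (intro less.prems(3)) auto
        also have "\<Union>(N ` (S \<union> T)) = W \<union> \<Union>((\<lambda>x. N x - W) ` T)"
          unfolding W_def by blast
        also have "card \<dots> = card W + card (\<Union>((\<lambda>x. N x - W) ` T))"
          using fW fN by (subst card_Un_disjoint) auto
        finally show ?thesis using tight W_def by simp
      qed
      ultimately obtain g where g: "inj_on g (X - S)" "\<forall>x\<in>X - S. g x \<in> N x - W"
        using less.hyps[of "X - S" "\<lambda>x. N x - W"] less.prems by auto
      have "f ` S \<subseteq> W" using f(2) W_def by blast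
      then have "inj_on (\<lambda>x. if x \<in> S then f x else g x) X"
        using f(1) g unfolding inj_on_def by (auto simp: image_subset_iff) (metis DiffI)+
      then show ?thesis
        using f g by (intro exI[of _ "\<lambda>x. if x \<in> S then f x else g x"]) auto
    next
      case False
      have "card {x} \<le> card (N x)" using less.prems(3)[of "{x}"] x by simp
      then obtain y where y: "y \<in> N x" by fastforce
      have "card (X - {x}) < card X" using x less.prems(1) by (meson card_Diff1_less)
      moreover have "card T \<le> card (\<Union>((\<lambda>z. N z - {y}) ` T))" if T: "T \<subseteq> X - {x}" for T
      proof (cases "T = {}")
        case ne: False
        have fT: "finite T" using T less.prems(1) by (meson finite_Diff finite_subset)
        have "T \<subseteq> X" "T \<noteq> X" using T x by auto
        then have "card (\<Union>(N ` T)) \<noteq> card T" "card T \<le> card (\<Union>(N ` T))"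
          using False ne less.prems(3) by auto
        \<comment> \<open>Removing \<open>y\<close> costs at most one neighbour, and
          \<open>T\<close>, not being tight, has one to spare.\<close>
        moreover have "card (\<Union>(N ` T)) - 1 \<le> card (\<Union>((\<lambda>z. N z - {y}) ` T))"
        proof -
          have "card (\<Union>(N ` T)) - 1 \<le> card (\<Union>(N ` T) - {y})"
            by (metis card_Diff_singleton_if diff_le_self order_refl)
          also have "\<Union>(N ` T) - {y} = \<Union>((\<lambda>z. N z - {y}) ` T)" by blast
          finally show ?thesis .
        qed
        ultimately show ?thesis by linarith
      qed simp
      ultimately obtain g where g: "inj_on g (X - {x})" "\<forall>z\<in>X - {x}. g z \<in> N z - {y}"
        using less.hyps[of "X - {x}" "\<lambda>z. N z - {y}"] less.prems by auto
      then have "inj_on (g(x := y)) X"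
        unfolding inj_on_def by auto
      then show ?thesis
        using g y by (intro exI[of _ "g(x := y)"]) auto
    qed
  qed simp
qed

section \<open>Cycle rank of induced subgraphs\<close>

text \<open>The set \<open>R\<close> meets every component, so as long as it is not everything some
  edge leaves it. Adding the outer end of that edge gains one vertex and at least one edge, so edges
  minus vertices never drops while \<open>R\<close> grows to the whole graph.\<close>

lemma card_induced_edges_le:
  assumes G: "simple_graph n E"
    and "R \<subseteq> {0..<n}"
    and "\<And>v. v < n \<Longrightarrow> \<exists>r\<in>R. (r, v) \<in> {(x, y). {x, y} \<in> E}\<^sup>*"
  shows "int (card {e \<in> E. e \<subseteq> R}) - int (card R) \<le> int (card E) - int n"
  using assms(2-)
proof (induction "n - card R" arbitrary: R rule: less_induct)
  case less
  have "E \<subseteq> Pow {0..<n}" using G unfolding simple_graph_def by blast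
  then have fE: "finite E" by (rule finite_subset) simp
  have fR: "finite R" using less.prems(1) finite_subset by blast
  show ?case
  proof (cases "R = {0..<n}")
    case True
    then have "{e \<in> E. e \<subseteq> R} = E" using G unfolding simple_graph_def by blast
    then show ?thesis using True by simp
  next
    case False
    then obtain v where v: "v < n" "v \<notin> R" using less.prems(1) by fastforce
    obtain r where r: "r \<in> R" "(r, v) \<in> {(x, y). {x, y} \<in> E}\<^sup>*" using less.prems(2) v by blast
    \<comment> \<open>Without an edge leaving \<open>R\<close>, the walk from \<open>r\<close> to
      \<open>v\<close> would stay inside \<open>R\<close>.\<close>
    have "\<exists>a\<in>R. \<exists>b. b \<notin> R \<and> {a, b} \<in> E"
    proof (rule ccontr)
      assume *: "\<not> ?thesis"
      from r(2) r(1) have "v \<in> R" by (induction rule: rtrancl_induct) (use * in auto)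
      then show False using v by simp
    qed
    then obtain a b where ab: "a \<in> R" "b \<notin> R" "{a, b} \<in> E" by blast
    then have bn: "b < n" using G unfolding simple_graph_def by fastforce
    have "card (insert b R) \<le> n"
      using less.prems(1) bn card_mono[of "{0..<n}" "insert b R"] by auto
    then have "n - card (insert b R) < n - card R" using fR ab by simp
    then have "int (card {e \<in> E. e \<subseteq> insert b R}) - int (card (insert b R)) \<le> int (card E) - int n"
      using less.hyps[of "insert b R"] less.prems bn by auto
    moreover have "card (insert {a, b} {e \<in> E. e \<subseteq> R}) \<le> card {e \<in> E. e \<subseteq> insert b R}"
      using ab fE by (intro card_mono) auto
    moreover have "card (insert {a, b} {e \<in> E. e \<subseteq> R}) = Suc (card {e \<in> E. e \<subseteq> R})"
      using ab fE by (subst card_insert_disjoint) auto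
    ultimately show ?thesis using fR ab by simp
  qed
qed

lemma equiv_connection: "equiv {0..<n} (connection n E)"
proof (rule equivI)
  have s: "sym ({(x, y). {x, y} \<in> E}\<^sup>*)"
    by (rule sym_rtrancl) (auto simp: sym_def insert_commute)
  show "sym (connection n E)"
    using s unfolding connection_def sym_def by blast
  show "trans (connection n E)"
    unfolding connection_def trans_def by auto
qed (auto simp: connection_def refl_on_def)

text \<open>Enlarge \<open>U\<close> by one representative of each component other than that of a
  fixed \<open>u\<close> in \<open>U\<close>. The result meets every component, has at most
  \<open>card C - 1\<close> new vertices and keeps all edges inside \<open>U\<close>, so the
  previous growth argument applies.\<close>

lemma cycle_rank_induced_subgraph:
  assumes G: "simple_graph n E" and U: "U \<subseteq> {0..<n}" "U \<noteq> {}"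
  shows "int (card {e \<in> E. e \<subseteq> U}) \<le> int (card U) + cycle_rank n E - 1"
proof -
  let ?c = "connection n E"
  obtain u where u: "u \<in> U" using U by blast
  define C where "C = components n E"
  have fC: "finite C"
    unfolding C_def components_def by (rule finite_quotient) (auto simp: connection_def)
  define c0 where "c0 = ?c `` {u}"
  have c0: "c0 \<in> C" using u U unfolding C_def components_def c0_def by (auto intro: quotientI)
  define g where "g c = (SOME x. x \<in> c)" for c :: "nat set"
  have g: "g c \<in> c" if "c \<in> C" for c
    using that in_quotient_imp_non_empty[OF equiv_connection]
    unfolding C_def components_def g_def by (metis some_in_eq)
  have cV: "c \<subseteq> {0..<n}" if "c \<in> C" for c
    using that unfolding C_def components_def
    by (rule in_quotient_imp_subset[OF equiv_connection])
  define R where "R = U \<union> g ` (C - {c0})"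
  have RV: "R \<subseteq> {0..<n}" using U g cV unfolding R_def by blast
  have "\<exists>r\<in>R. (r, v) \<in> {(x, y). {x, y} \<in> E}\<^sup>*" if v: "v < n" for v
  proof -
    let ?d = "?c `` {v}"
    have d: "?d \<in> C" using v unfolding C_def components_def by (auto intro: quotientI)
    show ?thesis
    proof (cases "?d = c0")
      case True
      then have "(u, v) \<in> ?c"
        using v unfolding c0_def by (auto simp: connection_def)
      then show ?thesis using u unfolding R_def connection_def by blast
    next
      case False
      then have "g ?d \<in> R" using d unfolding R_def by blast
      moreover have "(v, g ?d) \<in> ?c" using g[OF d] by simp
      then have "(g ?d, v) \<in> ?c" using equiv_connection by (metis equivE symE)
      ultimately show ?thesis unfolding connection_def by blast
    qed
  qed
  then have "int (card {e \<in> E. e \<subseteq> R}) - int (card R) \<le> int (card E) - int n"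
    using card_induced_edges_le[OF G RV] by blast
  moreover have "card {e \<in> E. e \<subseteq> U} \<le> card {e \<in> E. e \<subseteq> R}"
  proof (rule card_mono)
    have "E \<subseteq> Pow {0..<n}" using G unfolding simple_graph_def by blast
    then have "finite E" by (rule finite_subset) simp
    then show "finite {e \<in> E. e \<subseteq> R}" by simp
  qed (auto simp: R_def)
  moreover have "card R \<le> card U + (card C - 1)"
  proof -
    have "card R \<le> card U + card (g ` (C - {c0}))" unfolding R_def by (rule card_Un_le)
    also have "card (g ` (C - {c0})) \<le> card (C - {c0})" using fC by (intro card_image_le) simp
    finally show ?thesis using c0 by simp
  qed
  moreover have "card C \<ge> 1" using c0 fC by (metis One_nat_def Suc_leI card_gt_0_iff empty_iff)
  ultimately show ?thesis unfolding cycle_rank_def C_def by linarith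
qed

section \<open>Symmetric matrices whose inverse has zero diagonal\<close>

text \<open>Working with functions on an index set rather than with matrices lets vertices be
  deleted by shrinking \<open>U\<close>, with \<open>A\<close> and \<open>B\<close> unchanged and no
  renumbering.\<close>

definition hollow_inverse :: "'a set \<Rightarrow> ('a \<Rightarrow> 'a \<Rightarrow> real) \<Rightarrow> ('a \<Rightarrow> 'a \<Rightarrow> real) \<Rightarrow> bool" where
  "hollow_inverse U A B \<longleftrightarrow>
     (\<forall>i\<in>U. \<forall>j\<in>U. A i j = A j i \<and> B i j = B j i) \<and> (\<forall>i\<in>U. B i i = 0) \<and>
     (\<forall>i\<in>U. \<forall>j\<in>U. (\<Sum>k\<in>U. A i k * B k j) = of_bool (i = j))"

lemma hollow_inverseD:
  assumes "hollow_inverse U A B"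
  shows "\<And>i j. i \<in> U \<Longrightarrow> j \<in> U \<Longrightarrow> A i j = A j i"
    and "\<And>i j. i \<in> U \<Longrightarrow> j \<in> U \<Longrightarrow> B i j = B j i"
    and "\<And>i. i \<in> U \<Longrightarrow> B i i = 0"
    and "\<And>i j. i \<in> U \<Longrightarrow> j \<in> U \<Longrightarrow> (\<Sum>k\<in>U. A i k * B k j) = of_bool (i = j)"
  using assms unfolding hollow_inverse_def by blast+

text \<open>In the diagonal entry of \<open>A B = I\<close> at \<open>v\<close>, the term with
  \<open>A v v\<close> is killed by \<open>B v v = 0\<close>, so another term must be
  nonzero.\<close>

lemma hollow_inverse_neighbour:
  assumes H: "hollow_inverse U A B" and v: "v \<in> U"
  shows "\<exists>u\<in>U - {v}. A v u \<noteq> 0"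
proof (rule ccontr)
  assume *: "\<not> ?thesis"
  have "(\<Sum>k\<in>U. A v k * B k v) = 0"
    using * hollow_inverseD(3)[OF H v] by (intro sum.neutral) auto
  then show False using hollow_inverseD(4)[OF H v v] by simp
qed

text \<open>Row \<open>v\<close> of \<open>A B = I\<close> involves only the indices
  \<open>u\<close> and \<open>v\<close>, which forces \<open>B u j = 0\<close> for every
  \<open>j\<close> other than \<open>v\<close>. In the remaining rows and columns of the product,
  the term at \<open>u\<close> then vanishes through \<open>B\<close> and the term at
  \<open>v\<close> through \<open>A\<close>.\<close>

lemma hollow_inverse_delete_leaf:
  assumes H: "hollow_inverse U A B" and fU: "finite U"
    and uv: "u \<in> U" "v \<in> U" "u \<noteq> v"
    and leaf: "\<And>k. k \<in> U - {u, v} \<Longrightarrow> A v k = 0"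
  shows "hollow_inverse (U - {u, v}) A B"
proof -
  note D = hollow_inverseD[OF H]
  have split: "(\<Sum>k\<in>U. f k) = f u + f v + (\<Sum>k\<in>U - {u, v}. f k)" for f :: "'a \<Rightarrow> real"
  proof -
    have "(\<Sum>k\<in>U. f k) = (\<Sum>k\<in>U - {u, v}. f k) + (\<Sum>k\<in>{u, v}. f k)"
      using fU uv by (intro sum.subset_diff) auto
    then show ?thesis using uv by simp
  qed
  have row: "A v u * B u j + A v v * B v j = of_bool (v = j)" if j: "j \<in> U" for j
    using D(4)[OF uv(2) j] split[of "\<lambda>k. A v k * B k j"] leaf by simp
  have 1: "A v u * B u v = 1" using row[OF uv(2)] D(3)[OF uv(2)] by simp
  \<comment> \<open>Column \<open>u\<close> of the row identity reads
    \<open>A v v * B v u = 0\<close>, and \<open>B v u\<close> is nonzero by the preceding equation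
    and symmetry.\<close>
  then have 2: "A v v = 0" using row[OF uv(1)] D(3)[OF uv(1)] D(2)[OF uv(1,2)] uv by auto
  have 3: "B u j = 0" if "j \<in> U - {u, v}" for j
    using row[of j] 1 2 that by auto
  have "(\<Sum>k\<in>U - {u, v}. A i k * B k j) = of_bool (i = j)"
    if i: "i \<in> U - {u, v}" and j: "j \<in> U - {u, v}" for i j
  proof -
    have "A i v = 0" using leaf[OF i] D(1)[of i v] i uv by simp
    then show ?thesis using split[of "\<lambda>k. A i k * B k j"] 3[OF j] D(4)[of i j] i j by simp
  qed
  then show ?thesis using D unfolding hollow_inverse_def by simp
qed

text \<open>With \<open>z = B e\<^sub>x\<close> restricted to \<open>V\<close>, the block equations give first \<open>A\<^sub>V z = 0\<close>, since
  \<open>B x x = 0\<close>, and then, on multiplying \<open>A\<^sub>V B\<^sub>V + A y x e\<^sub>y z\<^sup>T = I\<close> by \<open>z\<^sup>T\<close>, that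
  \<open>(A y x * B y x) z = z\<close>.\<close>

lemma hollow_inverse_bridge:
  assumes H: "hollow_inverse U A B" and fU: "finite U" and V: "V \<subseteq> U"
    and y: "y \<in> V" and x: "x \<in> U - V"
    and cut: "\<And>i j. i \<in> V \<Longrightarrow> j \<in> U - V \<Longrightarrow> (i, j) \<noteq> (y, x) \<Longrightarrow> A i j = 0"
  shows "A y x * B y x = 0 \<or> A y x * B y x = 1"
proof -
  note D = hollow_inverseD[OF H]
  have fV: "finite V" using fU V finite_subset by blast
  define z where "z i = B i x" for i
  have split: "(\<Sum>k\<in>U. f k) = (\<Sum>k\<in>V. f k) + (\<Sum>k\<in>U - V. f k)" for f :: "'a \<Rightarrow> real"
    using sum.subset_diff[OF V fU, of f] by simp
  have across: "(\<Sum>k\<in>U - V. A i k * B k j) = of_bool (i = y) * (A y x * B x j)"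
    if i: "i \<in> V" for i j
  proof -
    have "(\<Sum>k\<in>U - V. A i k * B k j) = (\<Sum>k\<in>{x}. A i k * B k j)"
      using cut[OF i] x fU by (intro sum.mono_neutral_right) auto
    also have "\<dots> = of_bool (i = y) * (A y x * B x j)"
      using cut[OF i x] by auto
    finally show ?thesis .
  qed
  have ker: "(\<Sum>k\<in>V. A i k * z k) = 0" if i: "i \<in> V" for i
    using split[of "\<lambda>k. A i k * B k x"] across[OF i, of x] D(3)[of x] D(4)[of i x] i x V
    unfolding z_def by auto
  have rowy: "(\<Sum>k\<in>U. A i k * B k y) = of_bool (i = y)" if "i \<in> V" for i
    using D(4)[of i y] subsetD[OF V that] subsetD[OF V y] by simp
  \<comment> \<open>The identity is evaluated at the entry \<open>y\<close> only: pair
    \<open>z\<close> with column \<open>y\<close> of \<open>A B = I\<close>. The part inside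
    \<open>V\<close> dies by symmetry of \<open>A\<close> and \<open>ker\<close>; the bridge
    contributes \<open>z y\<close> times its weight.\<close>
  have "z y = (\<Sum>i\<in>V. z i * of_bool (i = y))"
    using y fV by simp
  also have "\<dots> = (\<Sum>i\<in>V. z i * (\<Sum>k\<in>U. A i k * B k y))"
    by (intro sum.cong refl) (simp add: rowy)
  also have "\<dots> = (\<Sum>i\<in>V. z i * (\<Sum>k\<in>V. A i k * B k y)) + (\<Sum>i\<in>V. z i * (of_bool (i = y) * (A y x * B x y)))"
    unfolding sum.distrib[symmetric]
    by (intro sum.cong refl) (simp only: split across distrib_left)
  also have "(\<Sum>i\<in>V. z i * (of_bool (i = y) * (A y x * B x y))) = z y * (A y x * B x y)"
    using y fV by (simp add: mult.assoc[symmetric] sum_distrib_right[symmetric])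
  also have "(\<Sum>i\<in>V. z i * (\<Sum>k\<in>V. A i k * B k y)) = (\<Sum>i\<in>V. \<Sum>k\<in>V. A k i * z i * B k y)"
    unfolding sum_distrib_left using D(1) V by (intro sum.cong refl) (auto simp: subset_iff)
  also have "\<dots> = (\<Sum>k\<in>V. (\<Sum>i\<in>V. A k i * z i) * B k y)"
    by (subst sum.swap) (simp add: sum_distrib_right)
  also have "\<dots> = 0" using ker by simp
  finally have "z y = z y * (A y x * B y x)"
    using D(2)[of x y] x y V by auto
  then show ?thesis unfolding z_def by auto
qed

section \<open>Edge weights and Hall's condition\<close>

lemma hollow_inverse_weight:
  assumes H: "hollow_inverse U A B" and fU: "finite U" and S: "S \<subseteq> U" "T \<subseteq> U" "S \<inter> T = {}"
    and nb: "\<And>i j. i \<in> S \<Longrightarrow> j \<in> U - T \<Longrightarrow> i \<noteq> j \<Longrightarrow> A i j = 0"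
  shows "(\<Sum>i\<in>S. \<Sum>j\<in>T. A i j * B i j) = card S"
proof -
  note D = hollow_inverseD[OF H]
  \<comment> \<open>By symmetry of \<open>B\<close> this is the diagonal entry of
    \<open>A B = I\<close> at \<open>i\<close>. The diagonal of \<open>A\<close> is unrestricted,
    but its term is killed by \<open>B i i = 0\<close>.\<close>
  have "(\<Sum>j\<in>T. A i j * B i j) = 1" if i: "i \<in> S" for i
  proof -
    have "(\<Sum>j\<in>T. A i j * B i j) = (\<Sum>j\<in>T. A i j * B j i)"
      using D(2) S i by (intro sum.cong) (auto simp: subset_iff)
    also have "\<dots> = (\<Sum>j\<in>U. A i j * B j i)"
      using nb[OF i] D(3)[of i] S i fU by (intro sum.mono_neutral_left) auto
    finally show ?thesis using D(4)[of i i] i S by auto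
  qed
  then show ?thesis by simp
qed

text \<open>The total edge weight, summed from either side of the bipartition, counts the vertices
  of that side.\<close>

lemma hollow_inverse_balanced:
  assumes H: "hollow_inverse (X \<union> Y) A B"
    and fin: "finite X" "finite Y" and disj: "X \<inter> Y = {}"
    and indX: "\<And>i j. i \<in> X \<Longrightarrow> j \<in> X \<Longrightarrow> i \<noteq> j \<Longrightarrow> A i j = 0"
    and indY: "\<And>i j. i \<in> Y \<Longrightarrow> j \<in> Y \<Longrightarrow> i \<noteq> j \<Longrightarrow> A i j = 0"
  shows "card X = card Y"
proof -
  have fU: "finite (X \<union> Y)" using fin by simp
  have "(\<Sum>i\<in>X. \<Sum>j\<in>Y. A i j * B i j) = card X"
    using disj indX by (intro hollow_inverse_weight[OF H fU]) blast+
  moreover have "(\<Sum>j\<in>Y. \<Sum>i\<in>X. A j i * B j i) = card Y"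
    using disj indY by (intro hollow_inverse_weight[OF H fU]) blast+
  moreover have "(\<Sum>j\<in>Y. \<Sum>i\<in>X. A j i * B j i) = (\<Sum>i\<in>X. \<Sum>j\<in>Y. A i j * B i j)"
    using hollow_inverseD(1,2)[OF H] by (subst sum.swap) (intro sum.cong refl, auto)
  ultimately show ?thesis by simp
qed

lemma hollow_inverse_hall_condition:
  assumes H: "hollow_inverse (X \<union> Y) A B"
    and fin: "finite X" "finite Y" and disj: "X \<inter> Y = {}"
    and indX: "\<And>i j. i \<in> X \<Longrightarrow> j \<in> X \<Longrightarrow> i \<noteq> j \<Longrightarrow> A i j = 0"
    and indY: "\<And>i j. i \<in> Y \<Longrightarrow> j \<in> Y \<Longrightarrow> i \<noteq> j \<Longrightarrow> A i j = 0"
    and degX: "\<And>x. x \<in> X \<Longrightarrow> 2 \<le> (\<Sum>y\<in>Y. of_bool (A x y \<noteq> 0) :: nat)"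
    and degY: "\<And>y. y \<in> Y \<Longrightarrow> 2 \<le> (\<Sum>x\<in>X. of_bool (A x y \<noteq> 0) :: nat)"
    and edges: "(\<Sum>x\<in>X. \<Sum>y\<in>Y. of_bool (A x y \<noteq> 0) :: nat) \<le> card X + card Y + 3"
    and S: "S \<subseteq> X"
  shows "card S \<le> card {y \<in> Y. \<exists>x\<in>S. A x y \<noteq> 0}"
proof (rule ccontr)
  note D = hollow_inverseD[OF H]
  define N where "N = {y \<in> Y. \<exists>x\<in>S. A x y \<noteq> 0}"
  assume "\<not> ?thesis"
  then have less: "card N < card S" unfolding N_def by simp
  have NY: "N \<subseteq> Y" unfolding N_def by blast
  have fS: "finite S" and fN: "finite N" using S NY fin finite_subset by blast+
  have fU: "finite (X \<union> Y)" using fin by simp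
  have SN0: "A i j = 0" if "i \<in> S" "j \<in> Y - N" for i j
    using that unfolding N_def by blast
  \<comment> \<open>\<open>F\<close> consists of the edges joining \<open>N\<close> to the outside
    of \<open>S\<close>, with the end in \<open>N\<close> first. Both the edge count and the weight
    count below are compared on \<open>F\<close>.\<close>
  define F where "F = {p \<in> N \<times> (X - S). A (fst p) (snd p) \<noteq> 0}"
  have fF: "finite F" unfolding F_def using fN fin by simp
  have over_F: "(\<Sum>y\<in>N. \<Sum>x\<in>X - S. A y x * B y x) = (\<Sum>(y, x)\<in>F. A y x * B y x)"
  proof -
    have "(\<Sum>y\<in>N. \<Sum>x\<in>X - S. A y x * B y x) = (\<Sum>(y, x)\<in>N \<times> (X - S). A y x * B y x)"
      by (rule sum.cartesian_product)
    also have "\<dots> = (\<Sum>(y, x)\<in>F. A y x * B y x)"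
      using fN fin by (intro sum.mono_neutral_right) (auto simp: F_def)
    finally show ?thesis .
  qed
  have card_F: "(\<Sum>y\<in>N. \<Sum>x\<in>X - S. of_bool (A x y \<noteq> 0) :: nat) = card F"
  proof -
    have "(\<Sum>y\<in>N. \<Sum>x\<in>X - S. of_bool (A x y \<noteq> 0) :: nat)
        = (\<Sum>p\<in>N \<times> (X - S). of_bool (A (snd p) (fst p) \<noteq> 0))"
      unfolding sum.cartesian_product by (simp add: case_prod_beta)
    also have "\<dots> = (\<Sum>p\<in>F. 1)"
      using fN fin D(1) NY by (intro sum.mono_neutral_cong_right) (auto simp: F_def subset_iff)
    finally show ?thesis by simp
  qed
  have wSN: "(\<Sum>i\<in>S. \<Sum>j\<in>N. A i j * B i j) = card S"
    using S NY disj indX SN0 by (intro hollow_inverse_weight[OF H fU]) blast+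
  have wNX: "(\<Sum>j\<in>N. \<Sum>i\<in>X. A j i * B j i) = card N"
    using NY disj indY by (intro hollow_inverse_weight[OF H fU]) blast+
  have wNS: "(\<Sum>j\<in>N. \<Sum>i\<in>S. A j i * B j i) = card S"
    unfolding wSN[symmetric] using S NY D(1,2)
    by (subst sum.swap) (intro sum.cong refl, auto simp: subset_iff)
  have balanced: "card X = card Y"
    by (rule hollow_inverse_balanced[OF H fin disj indX indY])
  have "(\<Sum>j\<in>N. \<Sum>i\<in>X. A j i * B j i)
      = (\<Sum>j\<in>N. \<Sum>i\<in>X - S. A j i * B j i) + (\<Sum>j\<in>N. \<Sum>i\<in>S. A j i * B j i)"
    by (simp add: sum.subset_diff[OF S fin(1)] sum.distrib)
  \<comment> \<open>All edges at \<open>S\<close> end in \<open>N\<close> and carry weight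
    \<open>card S\<close>, while the edges at \<open>N\<close> carry \<open>card N\<close> in total.
    The deficit must therefore be made up by \<open>F\<close>.\<close>
  then have wF: "(\<Sum>(y, x)\<in>F. A y x * B y x) = real (card N) - real (card S)"
    using wNX wNS over_F by simp
  \<comment> \<open>Edge count: \<open>S\<close> sends at least \<open>2 * card S\<close> edges, all
    into \<open>N\<close>; \<open>F\<close> adds \<open>card F\<close> further edges at
    \<open>N\<close>; each vertex of \<open>Y - N\<close> adds at least two. Balance turns the upper
    bound on the total into \<open>2 * card Y + 3\<close>.\<close>
  have "2 * card S \<le> (\<Sum>x\<in>S. \<Sum>y\<in>Y. of_bool (A x y \<noteq> 0) :: nat)"
    using sum_bounded_below[of S "2::nat" "\<lambda>x. \<Sum>y\<in>Y. of_bool (A x y \<noteq> 0)"] degX S by (auto simp: mult.commute)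
  also have "\<dots> = (\<Sum>x\<in>S. \<Sum>y\<in>N. of_bool (A x y \<noteq> 0))"
    using NY fin SN0 by (intro sum.cong refl sum.mono_neutral_right) auto
  also have "\<dots> = (\<Sum>y\<in>N. \<Sum>x\<in>S. of_bool (A x y \<noteq> 0))"
    by (rule sum.swap)
  finally have "2 * card S + card F \<le> (\<Sum>y\<in>N. \<Sum>x\<in>X. of_bool (A x y \<noteq> 0) :: nat)"
    unfolding card_F[symmetric] by (simp add: sum.subset_diff[OF S fin(1)] sum.distrib)
  moreover have "2 * card (Y - N) \<le> (\<Sum>y\<in>Y - N. \<Sum>x\<in>X. of_bool (A x y \<noteq> 0) :: nat)"
    using sum_bounded_below[of "Y - N" "2::nat" "\<lambda>y. \<Sum>x\<in>X. of_bool (A x y \<noteq> 0)"] degY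
    by (auto simp: mult.commute)
  moreover have "(\<Sum>x\<in>X. \<Sum>y\<in>Y. of_bool (A x y \<noteq> 0) :: nat)
      = (\<Sum>y\<in>Y - N. \<Sum>x\<in>X. of_bool (A x y \<noteq> 0)) + (\<Sum>y\<in>N. \<Sum>x\<in>X. of_bool (A x y \<noteq> 0))"
    by (subst sum.swap) (rule sum.subset_diff[OF NY fin(2)])
  moreover have "card (Y - N) + card N = card Y"
    using card_Diff_subset[OF fN NY] card_mono[OF fin(2) NY] by simp
  ultimately have "2 * card S + card F \<le> 2 * card N + 3"
    using edges balanced by linarith
  \<comment> \<open>A deficiency of two would already cost four, exceeding the surplus of three; a
    deficiency of one leaves room for one edge in \<open>F\<close>.\<close>
  with less have cS: "card S = card N + 1" and cF: "card F \<le> 1" by auto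
  from cF have "F = {} \<or> (\<exists>p. F = {p})"
    using fF by (metis card_1_singletonE card_eq_0_iff le_neq_implies_less less_one)
  then show False
  proof
    assume "F = {}"
    then show False using wF cS by simp
  next
    assume "\<exists>p. F = {p}"
    then obtain y x where F: "F = {(y, x)}" by auto
    then have yx: "y \<in> N" "x \<in> X - S" unfolding F_def by auto
    \<comment> \<open>The single edge of \<open>F\<close> is the only one leaving the union of
      \<open>S\<close> and \<open>N\<close>, hence a bridge. Its weight would have to be
      \<open>- 1\<close>.\<close>
    have "A y x * B y x = 0 \<or> A y x * B y x = 1"
    proof (rule hollow_inverse_bridge[OF H fU, of "S \<union> N"])
      fix i j assume ij: "i \<in> S \<union> N" "j \<in> X \<union> Y - (S \<union> N)" "(i, j) \<noteq> (y, x)"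
      show "A i j = 0"
      proof (cases "i \<in> S")
        case True
        then show ?thesis using ij S indX SN0 by blast
      next
        case False
        then have i: "i \<in> N" using ij by blast
        show ?thesis
        proof (cases "j \<in> X")
          case True
          then have "(i, j) \<notin> F" "j \<in> X - S" using ij F by auto
          then show ?thesis using i unfolding F_def by auto
        next
          case False
          then show ?thesis using ij i NY indY by blast
        qed
      qed
    qed (use yx S NY disj in auto)
    moreover have "A y x * B y x = - 1" using wF cS F by simp
    ultimately show False by linarith
  qed
qed

text \<open>Induction strips a leaf together with its neighbour, matching the two, until all degrees
  are at least two and Hall's condition is available. Sparsity is assumed for all pairs of subsets
  so that it passes to the smaller graph.\<close>

lemma hollow_inverse_matching:
  assumes "hollow_inverse (X \<union> Y) A B"
    and "finite X" "finite Y" and "X \<inter> Y = {}"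
    and "\<And>i j. i \<in> X \<Longrightarrow> j \<in> X \<Longrightarrow> i \<noteq> j \<Longrightarrow> A i j = 0"
    and "\<And>i j. i \<in> Y \<Longrightarrow> j \<in> Y \<Longrightarrow> i \<noteq> j \<Longrightarrow> A i j = 0"
    and "\<And>S T. S \<subseteq> X \<Longrightarrow> T \<subseteq> Y \<Longrightarrow> S \<union> T \<noteq> {} \<Longrightarrow>
      (\<Sum>x\<in>S. \<Sum>y\<in>T. of_bool (A x y \<noteq> 0) :: nat) \<le> card S + card T + 3"
  shows "\<exists>f. bij_betw f X Y \<and> (\<forall>x\<in>X. A x (f x) \<noteq> 0)"
  using assms
proof (induction "card X" arbitrary: X Y rule: less_induct)
  case less
  note H = less.prems(1) and fin = less.prems(2,3) and disj = less.prems(4)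
    and indX = less.prems(5) and indY = less.prems(6) and sparse = less.prems(7)
  note D = hollow_inverseD[OF H]
  have fU: "finite (X \<union> Y)" using fin by simp
  have sym: "A x y = A y x" if "x \<in> X" "y \<in> Y" for x y using D(1) that by blast
  \<comment> \<open>In the first case one end of the edge has no other neighbour. Otherwise each
    vertex has a neighbour by \<open>hollow_inverse_neighbour\<close>, and the failure of the first
    case supplies a second.\<close>
  consider (leaf) x y where "x \<in> X" "y \<in> Y" "A x y \<noteq> 0"
      "(\<forall>k\<in>Y - {y}. A x k = 0) \<or> (\<forall>k\<in>X - {x}. A y k = 0)"
    | (core) "\<And>x. x \<in> X \<Longrightarrow> 2 \<le> (\<Sum>y\<in>Y. of_bool (A x y \<noteq> 0) :: nat)"
      "\<And>y. y \<in> Y \<Longrightarrow> 2 \<le> (\<Sum>x\<in>X. of_bool (A x y \<noteq> 0) :: nat)"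
  proof (cases "\<exists>x y. x \<in> X \<and> y \<in> Y \<and> A x y \<noteq> 0 \<and>
      ((\<forall>k\<in>Y - {y}. A x k = 0) \<or> (\<forall>k\<in>X - {x}. A y k = 0))")
    case False
    have two: "2 \<le> (\<Sum>k\<in>K. of_bool (P k) :: nat)"
      if "finite K" "k \<in> K" "P k" "l \<in> K" "P l" "k \<noteq> l" for K :: "'a set" and P k l
    proof -
      have "(\<Sum>k\<in>{k, l}. of_bool (P k) :: nat) \<le> (\<Sum>k\<in>K. of_bool (P k))"
        using that by (intro sum_mono2) auto
      then show ?thesis using that by simp
    qed
    have "2 \<le> (\<Sum>y\<in>Y. of_bool (A x y \<noteq> 0) :: nat)" if x: "x \<in> X" for x
    proof -
      obtain y where y: "y \<in> Y" "A x y \<noteq> 0"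
        using hollow_inverse_neighbour[OF H, of x] x indX by blast
      then obtain y' where "y' \<in> Y - {y}" "A x y' \<noteq> 0" using False x by blast
      then show ?thesis using two[OF fin(2), of y "\<lambda>y. A x y \<noteq> 0" y'] y by auto
    qed
    moreover have "2 \<le> (\<Sum>x\<in>X. of_bool (A x y \<noteq> 0) :: nat)" if y: "y \<in> Y" for y
    proof -
      obtain x where x: "x \<in> X" "A y x \<noteq> 0"
        using hollow_inverse_neighbour[OF H, of y] y indY by blast
      have xy: "A x y \<noteq> 0" using sym[OF x(1) y] x(2) by simp
      then obtain x' where x': "x' \<in> X - {x}" "A y x' \<noteq> 0" using False x(1) y by blast
      then have "A x' y \<noteq> 0" using sym[OF _ y, of x'] by simp
      then show ?thesis using two[OF fin(1), of x "\<lambda>x. A x y \<noteq> 0" x'] x(1) xy x'(1) by auto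
    qed
    ultimately show ?thesis using that(2) by blast
  qed (use that(1) in blast)
  then show ?case
  proof cases
    case leaf
    have xy: "x \<noteq> y" using leaf disj by blast
    have "hollow_inverse (X \<union> Y - {x, y}) A B"
      using leaf(4)
    proof
      assume *: "\<forall>k\<in>Y - {y}. A x k = 0"
      have "hollow_inverse (X \<union> Y - {y, x}) A B"
        using * leaf xy indX by (intro hollow_inverse_delete_leaf[OF H fU]) auto
      then show ?thesis by (simp add: insert_commute)
    next
      assume *: "\<forall>k\<in>X - {x}. A y k = 0"
      show ?thesis
        using * leaf xy indY by (intro hollow_inverse_delete_leaf[OF H fU]) auto
    qed
    moreover have "X \<union> Y - {x, y} = (X - {x}) \<union> (Y - {y})" using leaf disj by blast
    ultimately have H': "hollow_inverse ((X - {x}) \<union> (Y - {y})) A B" by simp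
    have sparse': "(\<Sum>x\<in>S. \<Sum>y\<in>T. of_bool (A x y \<noteq> 0) :: nat) \<le> card S + card T + 3"
      if "S \<subseteq> X - {x}" "T \<subseteq> Y - {y}" "S \<union> T \<noteq> {}" for S T
      using sparse that by blast
    have "card (X - {x}) < card X" using leaf(1) fin(1) by (meson card_Diff1_less)
    then have "\<exists>f. bij_betw f (X - {x}) (Y - {y}) \<and> (\<forall>x\<in>X - {x}. A x (f x) \<noteq> 0)"
      by (rule less.hyps[OF _ H' _ _ _ _ _ sparse']) (use fin disj indX indY in auto)
    then obtain f where f: "bij_betw f (X - {x}) (Y - {y})" "\<forall>z\<in>X - {x}. A z (f z) \<noteq> 0" by blast
    have "bij_betw (f(x := y)) (X - {x}) (Y - {y})"
      using f(1) by (subst bij_betw_cong[of _ _ f]) auto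
    then have "bij_betw (f(x := y)) ((X - {x}) \<union> {x}) ((Y - {y}) \<union> {y})"
      by (intro bij_betw_combine) auto
    then have "bij_betw (f(x := y)) X Y" using leaf by (simp add: insert_absorb)
    then show ?thesis using f(2) leaf by (intro exI[of _ "f(x := y)"]) auto
  next
    case core
    show ?thesis
    proof (cases "X \<union> Y = {}")
      case False
      have "\<exists>f. inj_on f X \<and> (\<forall>x\<in>X. f x \<in> {y \<in> Y. A x y \<noteq> 0})"
      proof (rule hall_marriage[OF fin(1)])
        fix S assume S: "S \<subseteq> X"
        have "(\<Union>x\<in>S. {y \<in> Y. A x y \<noteq> 0}) = {y \<in> Y. \<exists>x\<in>S. A x y \<noteq> 0}" by blast
        then show "card S \<le> card (\<Union>x\<in>S. {y \<in> Y. A x y \<noteq> 0})"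
          using hollow_inverse_hall_condition[OF H fin disj indX indY core sparse[OF _ _ False] S]
          by simp
      qed (use fin in simp)
      then obtain f where f: "inj_on f X" "\<forall>x\<in>X. f x \<in> Y \<and> A x (f x) \<noteq> 0" by blast
      \<comment> \<open>Equal class sizes turn the injection from Hall's theorem into a
        bijection.\<close>
      have "card X = card Y" by (rule hollow_inverse_balanced[OF H fin disj indX indY])
      moreover have "f ` X \<subseteq> Y" using f(2) by blast
      ultimately have "f ` X = Y"
        using f(1) fin by (metis card_image card_subset_eq)
      then show ?thesis using f unfolding bij_betw_def by blast
    qed (auto simp: bij_betw_def)
  qed
qed

section \<open>Parter graphs and perfect matchings\<close>

lemma index_mult_adj_mat:
  assumes A: "A \<in> carrier_mat n n" and ij: "i < n" "j < n"
  shows "(\<Sum>k\<in>{0..<n}. A $$ (i, k) * adj_mat A $$ (k, j)) = det A * of_bool (i = j)"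
proof -
  have "(\<Sum>k\<in>{0..<n}. A $$ (i, k) * adj_mat A $$ (k, j)) = (A * adj_mat A) $$ (i, j)"
    using A adj_mat(1)[OF A] ij by (simp add: scalar_prod_def)
  then show ?thesis using adj_mat(2)[OF A] ij by simp
qed

lemma adj_mat_diag:
  assumes "A \<in> carrier_mat n n" and "v < n"
  shows "adj_mat A $$ (v, v) = det (mat_delete A v v)"
  using assms by (simp add: adj_mat_def cofactor_def)

text \<open>With \<open>C\<close> the adjugate, transposing \<open>A C = det A I\<close> shows that
  the transpose of \<open>C\<close> is a left adjugate as well. Evaluating the triple product of
  that transpose, \<open>A\<close> and \<open>C\<close> in two ways identifies both after division
  by \<open>det A\<close>.\<close>

lemma adj_mat_symmetric:
  fixes A :: "real mat"
  assumes A: "A \<in> carrier_mat n n" and sym: "A\<^sup>T = A" and d: "det A \<noteq> 0" and ij: "i < n" "j < n"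
  shows "adj_mat A $$ (i, j) = adj_mat A $$ (j, i)"
proof -
  let ?C = "adj_mat A"
  note C = adj_mat[OF A]
  have CT: "?C\<^sup>T \<in> carrier_mat n n" using C(1) by simp
  have "?C\<^sup>T * A = (A * ?C)\<^sup>T" using transpose_mult[OF A C(1)] sym by simp
  then have *: "?C\<^sup>T * A = det A \<cdot>\<^sub>m 1\<^sub>m n" using C(2) by (auto intro!: eq_matI)
  have "(?C\<^sup>T * A) * ?C = ?C\<^sup>T * (A * ?C)" by (rule assoc_mult_mat[OF CT A C(1)])
  then have "det A \<cdot>\<^sub>m ?C = det A \<cdot>\<^sub>m ?C\<^sup>T"
    unfolding * C(2) using C(1) CT
    by (simp add: mult_smult_assoc_mat[OF one_carrier_mat C(1)] mult_smult_distrib[OF CT one_carrier_mat])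
  then have "(det A \<cdot>\<^sub>m ?C) $$ (i, j) = (det A \<cdot>\<^sub>m ?C\<^sup>T) $$ (i, j)" by simp
  then show ?thesis using d ij C(1) by simp
qed

text \<open>Writing the inverse as the adjugate over \<open>det A\<close> exposes its diagonal
  entries as principal minors, since diagonal cofactors have sign plus.\<close>

lemma parter_graph_hollow_inverse:
  assumes "parter_graph n E"
  shows "\<exists>A B. hollow_inverse {0..<n} A B \<and> (\<forall>i<n. \<forall>j<n. i \<noteq> j \<longrightarrow> (A i j \<noteq> 0 \<longleftrightarrow> {i, j} \<in> E))"
proof -
  obtain A where "A \<in> graph_matrices n E" and inv: "invertible_mat A"
    and del: "\<And>v. v < n \<Longrightarrow> det (mat_delete A v v) = 0"
    using assms unfolding parter_graph_def by blast
  then have A: "A \<in> carrier_mat n n" and sym: "A\<^sup>T = A"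
    and E: "\<forall>i<n. \<forall>j<n. i \<noteq> j \<longrightarrow> (A $$ (i, j) \<noteq> 0 \<longleftrightarrow> {i, j} \<in> E)"
    unfolding graph_matrices_def by auto
  obtain B where "A * B = 1\<^sub>m n" "B * A = 1\<^sub>m (dim_row B)"
    using inv A unfolding invertible_mat_def inverts_mat_def by auto
  then have AB: "A * B = 1\<^sub>m n" and B: "B \<in> carrier_mat n n"
    using A by (auto intro!: carrier_matI) (metis carrier_matD(2) index_mult_mat(3) index_one_mat(3))+
  have "det A * det B = 1" using det_mult[OF A B] AB by simp
  then have d: "det A \<noteq> 0" by auto
  have "hollow_inverse {0..<n} (\<lambda>i j. A $$ (i, j)) (\<lambda>i j. adj_mat A $$ (i, j) / det A)"
    unfolding hollow_inverse_def
  proof (intro conjI ballI)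
    fix i j assume ij: "i \<in> {0..<n}" "j \<in> {0..<n}"
    have "A\<^sup>T $$ (i, j) = A $$ (j, i)" using ij A by simp
    then show "A $$ (i, j) = A $$ (j, i)" using sym by simp
    show "adj_mat A $$ (i, j) / det A = adj_mat A $$ (j, i) / det A"
      using adj_mat_symmetric[OF A sym d] ij by simp
    show "(\<Sum>k\<in>{0..<n}. A $$ (i, k) * (adj_mat A $$ (k, j) / det A)) = of_bool (i = j)"
      using index_mult_adj_mat[OF A, of i j] ij d
      by (simp add: sum_divide_distrib[symmetric])
  next
    fix i assume "i \<in> {0..<n}"
    then show "adj_mat A $$ (i, i) / det A = 0" using adj_mat_diag[OF A] del by simp
  qed
  then show ?thesis using E by blast
qed

section \<open>A Parter matrix built from a perfect matching\<close>

lemma perfect_matching_imp_parter_graph: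
  assumes G: "simple_graph n E" and bip: "bipartite n E" and pm: "has_perfect_matching n E"
  shows "parter_graph n E"
proof -
  obtain X Y where XY: "X \<union> Y = {0..<n}" "X \<inter> Y = {}" "\<forall>e\<in>E. \<exists>x\<in>X. \<exists>y\<in>Y. e = {x, y}"
    using bip unfolding bipartite_def by blast
  have opposite: "(i \<in> X) \<noteq> (j \<in> X)" if "{i, j} \<in> E" for i j
    using XY that by (fastforce simp: doubleton_eq_iff)
  obtain M where M: "M \<subseteq> E" "\<forall>e\<in>M. \<forall>f\<in>M. e \<noteq> f \<longrightarrow> e \<inter> f = {}" "\<Union>M = {0..<n}"
    using pm unfolding has_perfect_matching_def by blast
  have unique: "k = l" if "{i, k} \<in> M" "{i, l} \<in> M" for i k l
    using M(2) that by (metis doubleton_eq_iff insert_disjoint(1) insertI1)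
  have mate: "\<exists>m<n. {m, i} \<in> M" if i: "i < n" for i
  proof -
    obtain e where e: "e \<in> M" "i \<in> e" using M(3) i by (metis UnionE atLeastLessThan_iff le0)
    then have "card e = 2" "e \<subseteq> {0..<n}" using G M(1) unfolding simple_graph_def by blast+
    then obtain m where "e = {m, i}" using e(2) by (auto simp: card_2_iff insert_commute)
    then show ?thesis using e(1) \<open>e \<subseteq> {0..<n}\<close> by auto
  qed
  \<comment> \<open>Each row has exactly one entry \<open>real n + 1\<close>, and its other entries
    are 0 or 1, so that entry exceeds the sum of the rest.\<close>
  define a :: "nat \<Rightarrow> nat \<Rightarrow> real"
    where "a i j = (if {i, j} \<in> M then real n + 1 else of_bool ({i, j} \<in> E))" for i j
  have a_zero: "a i j = 0" if "(i \<in> X) = (j \<in> X)" for i j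
    using opposite that M(1) unfolding a_def by auto
  text \<open>The weight of a matching edge dominates the remaining entries of its row.\<close>
  have kernel: "y j = 0"
    if y: "\<And>i. i < n \<Longrightarrow> (\<Sum>k\<in>{0..<n}. a i k * y k) = 0" and j: "j < n" for y j
  proof -
    have "Max ((\<lambda>k. \<bar>y k\<bar>) ` {0..<n}) \<in> (\<lambda>k. \<bar>y k\<bar>) ` {0..<n}"
      using j by (intro Max_in) auto
    then obtain i where i: "i < n" and "\<bar>y i\<bar> = Max ((\<lambda>k. \<bar>y k\<bar>) ` {0..<n})" by auto
    then have max: "\<bar>y k\<bar> \<le> \<bar>y i\<bar>" if "k < n" for k using that by simp
    \<comment> \<open>Use the equation of row \<open>m\<close>, the mate of the index
      \<open>i\<close> where the absolute value of \<open>y\<close> is largest: there the dominant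
      entry multiplies \<open>y i\<close>.\<close>
    obtain m where m: "m < n" "{m, i} \<in> M" using mate[OF i] by blast
    have small: "\<bar>a m k\<bar> \<le> 1" if "k \<noteq> i" for k
      using unique[OF m(2), of k] that unfolding a_def by auto
    have "(real n + 1) * y i = - (\<Sum>k\<in>{0..<n} - {i}. a m k * y k)"
      using y[OF m(1)] i m(2) sum.remove[of "{0..<n}" i "\<lambda>k. a m k * y k"] by (simp add: a_def)
    then have "(real n + 1) * \<bar>y i\<bar> = \<bar>\<Sum>k\<in>{0..<n} - {i}. a m k * y k\<bar>"
      by (metis abs_minus_cancel abs_mult abs_of_nonneg of_nat_0_le_iff add_nonneg_nonneg zero_le_one)
    also have "\<dots> \<le> (\<Sum>k\<in>{0..<n} - {i}. \<bar>a m k * y k\<bar>)" by (rule sum_abs)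
    also have "\<dots> \<le> (\<Sum>k\<in>{0..<n} - {i}. 1 * \<bar>y i\<bar>)"
      unfolding abs_mult using small max by (intro sum_mono mult_mono) auto
    also have "\<dots> \<le> real n * \<bar>y i\<bar>" using i by (simp add: mult_right_mono)
    finally have "\<bar>y i\<bar> \<le> 0" by (simp add: algebra_simps)
    then show ?thesis using max[OF j] by simp
  qed
  define A where "A = mat n n (\<lambda>(i, j). a i j)"
  have A: "A \<in> carrier_mat n n" unfolding A_def by simp
  have A_index: "A $$ (i, j) = a i j" if "i < n" "j < n" for i j
    using that unfolding A_def by simp
  have "A \<in> graph_matrices n E"
  proof -
    have "A\<^sup>T = A" by (rule eq_matI) (auto simp: A_def a_def insert_commute)
    then show ?thesis
      using A M(1) unfolding graph_matrices_def by (auto simp: A_index a_def)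
  qed
  moreover have d: "det A \<noteq> 0"
  proof
    assume "det A = 0"
    then obtain v where v: "v \<in> carrier_vec n" "v \<noteq> 0\<^sub>v n" "A *\<^sub>v v = 0\<^sub>v n"
      using det_0_iff_vec_prod_zero[OF A] by blast
    have "(\<Sum>k\<in>{0..<n}. a i k * v $ k) = 0" if i: "i < n" for i
    proof -
      have "(A *\<^sub>v v) $ i = (\<Sum>k\<in>{0..<n}. a i k * v $ k)"
        using A v(1) i by (simp add: scalar_prod_def A_index)
      then show ?thesis using v(3) i by simp
    qed
    then have "v $ j = 0" if "j < n" for j using kernel[of "\<lambda>k. v $ k"] that by blast
    then show False using v(1,2) by (metis eq_vecI carrier_vecD index_zero_vec)
  qed
  moreover have "invertible_mat A"
  proof -
    let ?B = "(1 / det A) \<cdot>\<^sub>m adj_mat A"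
    have B: "?B \<in> carrier_mat n n" using adj_mat(1)[OF A] by simp
    have "A * ?B = 1\<^sub>m n"
      using d by (intro eq_matI) (simp_all add: mult_smult_distrib[OF A adj_mat(1)[OF A]] adj_mat(2)[OF A])
    moreover have "?B * A = 1\<^sub>m n"
      using d
      by (intro eq_matI) (simp_all add: mult_smult_assoc_mat[OF adj_mat(1)[OF A] A] adj_mat(3)[OF A])
    ultimately show ?thesis
      using A B unfolding invertible_mat_def inverts_mat_def by (intro conjI exI[of _ ?B]) auto
  qed
  moreover have "det (mat_delete A v v) = 0" if v: "v < n" for v
  proof -
    \<comment> \<open>Restrict column \<open>v\<close> of the adjugate to the colour class of
      \<open>v\<close>. Rows in that class annihilate it since they vanish on the class; for the
      other rows the restriction loses nothing, and the sum is an off-diagonal entry of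
      \<open>A\<close> times its adjugate. So \<open>y\<close> is in the kernel, and
      \<open>y v\<close> is the minor at \<open>v\<close>.\<close>
    define y where "y k = of_bool ((k \<in> X) = (v \<in> X)) * adj_mat A $$ (k, v)" for k
    have "(\<Sum>k\<in>{0..<n}. a i k * y k) = 0" if i: "i < n" for i
    proof (cases "(i \<in> X) = (v \<in> X)")
      case True
      then have "a i k * y k = 0" for k using a_zero[of i k] unfolding y_def by auto
      then show ?thesis by (intro sum.neutral) blast
    next
      case False
      then have "a i k * y k = A $$ (i, k) * adj_mat A $$ (k, v)" if "k < n" for k
        using a_zero[of i k] A_index[OF i that] unfolding y_def by auto
      then have "(\<Sum>k\<in>{0..<n}. a i k * y k) = det A * of_bool (i = v)"
        using index_mult_adj_mat[OF A i v] by simp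
      then show ?thesis using False by auto
    qed
    then have "y v = 0" using v by (rule kernel)
    then show ?thesis using adj_mat_diag[OF A v] unfolding y_def by simp
  qed
  ultimately show ?thesis unfolding parter_graph_def by blast
qed

text \<open>The cycle rank enters through sparsity: rank at most four leaves every nonempty induced
  subgraph at most three more edges than vertices, as \<open>hollow_inverse_matching\<close>
  demands.\<close>

lemma parter_graph_imp_perfect_matching:
  assumes G: "simple_graph n E" and bip: "bipartite n E" and rank: "cycle_rank n E \<le> 4"
    and parter: "parter_graph n E"
  shows "has_perfect_matching n E"
proof -
  obtain X Y where XY: "X \<union> Y = {0..<n}" "X \<inter> Y = {}" "\<forall>e\<in>E. \<exists>x\<in>X. \<exists>y\<in>Y. e = {x, y}"
    using bip unfolding bipartite_def by blast
  obtain A B where H: "hollow_inverse {0..<n} A B"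
    and E: "\<And>i j. i < n \<Longrightarrow> j < n \<Longrightarrow> i \<noteq> j \<Longrightarrow> A i j \<noteq> 0 \<longleftrightarrow> {i, j} \<in> E"
    using parter_graph_hollow_inverse[OF parter] by blast
  have fin: "finite X" "finite Y" using XY(1) by (metis finite_Un finite_atLeastLessThan)+
  have less: "i < n" if "i \<in> X \<or> i \<in> Y" for i using that XY(1) by auto
  have opposite: "(i \<in> X) \<noteq> (j \<in> X)" if "{i, j} \<in> E" for i j
    using XY that by (fastforce simp: doubleton_eq_iff)
  have XnY: "x \<notin> Y" if "x \<in> X" for x using that XY(2) by blast
  have fE: "finite E"
    using G unfolding simple_graph_def by (intro finite_subset[of E "Pow {0..<n}"]) auto
  have "\<exists>f. bij_betw f X Y \<and> (\<forall>x\<in>X. A x (f x) \<noteq> 0)"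
  proof (rule hollow_inverse_matching[of X Y A B])
    show "hollow_inverse (X \<union> Y) A B" using H XY(1) by simp
    show "A i j = 0" if "i \<in> X" "j \<in> X" "i \<noteq> j" for i j
      using E[of i j] opposite[of i j] that less by blast
    show "A i j = 0" if "i \<in> Y" "j \<in> Y" "i \<noteq> j" for i j
      using E[of i j] opposite[of i j] that less XnY by blast
  next
    fix S T assume ST: "S \<subseteq> X" "T \<subseteq> Y" "S \<union> T \<noteq> {}"
    have fST: "finite S" "finite T" using ST fin finite_subset by blast+
    let ?P = "{p \<in> S \<times> T. A (fst p) (snd p) \<noteq> 0}"
    have "(\<Sum>x\<in>S. \<Sum>y\<in>T. of_bool (A x y \<noteq> 0) :: nat)
        = (\<Sum>p\<in>S \<times> T. of_bool (A (fst p) (snd p) \<noteq> 0))"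
      unfolding sum.cartesian_product by (simp add: case_prod_beta)
    also have "\<dots> = (\<Sum>p\<in>?P. 1)"
      using fST by (intro sum.mono_neutral_cong_right) auto
    also have "\<dots> = card ?P" by simp
    \<comment> \<open>Nonzero entries between \<open>S\<close> and \<open>T\<close> correspond to
      distinct edges, as the two classes are disjoint.\<close>
    also have "\<dots> \<le> card {e \<in> E. e \<subseteq> S \<union> T}"
    proof (rule card_inj_on_le)
      show "inj_on (\<lambda>p. {fst p, snd p}) ?P"
        using ST XnY by (auto simp: inj_on_def doubleton_eq_iff)
      show "(\<lambda>p. {fst p, snd p}) ` ?P \<subseteq> {e \<in> E. e \<subseteq> S \<union> T}"
      proof clarsimp
        fix x y assume xy: "x \<in> S" "y \<in> T" "A x y \<noteq> 0"
        then have "x \<noteq> y" "x < n" "y < n" using ST XnY less by blast+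
        then show "{x, y} \<in> E" using E xy by blast
      qed
    qed (use fE in simp)
    finally show "(\<Sum>x\<in>S. \<Sum>y\<in>T. of_bool (A x y \<noteq> 0) :: nat) \<le> card S + card T + 3"
      using cycle_rank_induced_subgraph[OF G _ ST(3)] Un_mono[OF ST(1,2)] XY(1) rank
        card_Un_le[of S T]
      by fastforce
  qed (use fin XY in auto)
  then obtain f where f: "bij_betw f X Y" "\<forall>x\<in>X. A x (f x) \<noteq> 0" by blast
  have fX: "f x \<in> Y" if "x \<in> X" for x using f(1) that by (rule bij_betwE[rule_format])
  show ?thesis unfolding has_perfect_matching_def
  proof (intro exI[of _ "(\<lambda>x. {x, f x}) ` X"] conjI ballI impI)
    show "(\<lambda>x. {x, f x}) ` X \<subseteq> E"
    proof clarify
      fix x assume x: "x \<in> X"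
      then have "x \<noteq> f x" "x < n" "f x < n" using fX XnY less by metis+
      then show "{x, f x} \<in> E" using E f(2) x by blast
    qed
  next
    fix e e' assume "e \<in> (\<lambda>x. {x, f x}) ` X" "e' \<in> (\<lambda>x. {x, f x}) ` X" and ne: "e \<noteq> e'"
    then obtain x x' where x: "x \<in> X" "e = {x, f x}" "x' \<in> X" "e' = {x', f x'}" by blast
    then have "x \<noteq> x'" using ne by blast
    moreover from this have "f x \<noteq> f x'" using f(1) x unfolding bij_betw_def inj_on_def by blast
    ultimately show "e \<inter> e' = {}" using x fX XnY by auto
  next
    have "f ` X = Y" using f(1) unfolding bij_betw_def by blast
    then show "\<Union>((\<lambda>x. {x, f x}) ` X) = {0..<n}" using XY(1) by blast
  qed
qed

theorem theorem1p4:
  fixes n :: nat and E :: "nat set set"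
  assumes "simple_graph n E"
    and "bipartite n E"
    and "cycle_rank n E = 4"
  shows "parter_graph n E \<longleftrightarrow> has_perfect_matching n E"
  using assms parter_graph_imp_perfect_matching perfect_matching_imp_parter_graph by auto

end
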